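(* Let $G$ be a graph of order $n\geq 26$. If $\rho(G)\geq \rho(K_{1,n-1}^+)$, then $G$ contains two cycles with the same length unless $G\cong K_{1,n-1}^+$.
   Context: All graphs are finite, simple and undirected. The order of a graph is its number of vertices. $\rho(G)$ denotes the spectral radius of $G$, i.e. the largest eigenvalue of its adjacency matrix $A(G)$. $K_{a,b}$ is the complete bipartite graph with parts of sizes $a$ and $b$. $K_{1,n-1}^+$ is the graph on $n$ vertices obtained from the star $K_{1,n-1}$ by adding one edge between two vertices of its independent set of size $n-1$ (two leaves). "Two cycles with the same length" means two distinct cycles (as subgraphs, not necessarily disjoint) having the same number of edges. *)

theory Defs
  imports
    "Graph_Theory.Graph_Theory"
    "Jordan_Normal_Form.Spectral_Radius"
begin

text \<open>
  A finite simple undirected graph is a \<^locale>\<open>pair_graph\<close>: a finite, loopfree, symmetric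
  digraph without parallel arcs, in which an undirected edge is a pair of opposite arcs.
  Isomorphism of such graphs is \<^const>\<open>digraph_iso\<close>.
\<close>


section \<open>The spectral radius of a graph\<close>

definition adj_matrix :: "'a list \<Rightarrow> 'a pair_pre_digraph \<Rightarrow> real mat" where
  "adj_matrix vs G =
     mat (length vs) (length vs) (\<lambda>(i, j). if (vs ! i, vs ! j) \<in> parcs G then 1 else 0)"

text \<open>
  The rows and columns of the adjacency matrix are indexed by an arbitrary enumeration of the
  vertices; its spectrum does not depend on the enumeration (\<open>spectrum_adj_matrix_cong\<close> below).
\<close>

definition vertex_list :: "'a pair_pre_digraph \<Rightarrow> 'a list" where
  "vertex_list G = (SOME vs. distinct vs \<and> set vs = pverts G)"

definition adjacency_matrix :: "'a pair_pre_digraph \<Rightarrow> real mat" where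
  "adjacency_matrix G = adj_matrix (vertex_list G) G"

text \<open>
  The largest eigenvalue, not the largest modulus of an eigenvalue. \<^const>\<open>Max\<close> is only
  meaningful if there is at least one vertex.
\<close>

definition graph_spectral_radius :: "'a pair_pre_digraph \<Rightarrow> real" where
  "graph_spectral_radius G = Max (spectrum (adjacency_matrix G))"

lemma vertex_list:
  assumes "finite (pverts G)"
  shows "distinct (vertex_list G)" "set (vertex_list G) = pverts G"
  using someI_ex[of "\<lambda>vs. distinct vs \<and> set vs = pverts G"] finite_distinct_list[OF assms]
  unfolding vertex_list_def by auto

lemma eigenvalue_adj_matrix_iff:
  assumes d: "distinct vs"
  shows "eigenvalue (adj_matrix vs G) k \<longleftrightarrow>
    (\<exists>x. (\<exists>v\<in>set vs. x v \<noteq> 0) \<and>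
         (\<forall>u\<in>set vs. (\<Sum>v | v \<in> set vs \<and> (u, v) \<in> parcs G. x v) = k * x u))"
    (is "?L \<longleftrightarrow> ?R")
proof -
  let ?n = "length vs"
  let ?A = "adj_matrix vs G"
  have dims: "dim_row ?A = ?n" "dim_col ?A = ?n" by (auto simp: adj_matrix_def)
  have entry: "(?A *\<^sub>v vec ?n (\<lambda>i. x (vs ! i))) $ i
      = (\<Sum>v | v \<in> set vs \<and> (vs ! i, v) \<in> parcs G. x v)" if i: "i < ?n" for x i
  proof -
    have "(?A *\<^sub>v vec ?n (\<lambda>i. x (vs ! i))) $ i
        = (\<Sum>j<?n. (if (vs ! i, vs ! j) \<in> parcs G then x (vs ! j) else 0))"
      using i by (auto simp: adj_matrix_def scalar_prod_def atLeast0LessThan intro!: sum.cong)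
    also have "\<dots> = (\<Sum>v\<in>set vs. (if (vs ! i, v) \<in> parcs G then x v else 0))"
      by (rule sum.reindex_bij_betw[OF bij_betw_nth[OF d refl refl]])
    also have "\<dots> = (\<Sum>v | v \<in> set vs \<and> (vs ! i, v) \<in> parcs G. x v)"
      by (rule sum.inter_filter[symmetric]) simp
    finally show ?thesis .
  qed
  show ?thesis
  proof
    assume ?L
    then obtain w where "w \<in> carrier_vec ?n" and w': "w \<noteq> 0\<^sub>v ?n" "?A *\<^sub>v w = k \<cdot>\<^sub>v w"
      unfolding eigenvalue_def eigenvector_def dims by blast
    then have "dim_vec w = ?n" by (simp only: carrier_vec_def mem_Collect_eq)
    note w = this w'
    define x where "x v = w $ (the_inv_into {..<?n} (\<lambda>i. vs ! i) v)" for v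
    have inj: "inj_on (\<lambda>i. vs ! i) {..<?n}"
      using d by (auto simp: inj_on_def nth_eq_iff_index_eq)
    have xi: "x (vs ! i) = w $ i" if "i < ?n" for i
      using that by (simp add: x_def the_inv_into_f_f[OF inj])
    have wx: "w = vec ?n (\<lambda>i. x (vs ! i))"
      using w(1) by (intro eq_vecI) (auto simp: xi)
    have "\<exists>i<?n. w $ i \<noteq> 0"
    proof (rule ccontr)
      assume "\<not> (\<exists>i<?n. w $ i \<noteq> 0)"
      then have "w = 0\<^sub>v ?n" using w(1) by (intro eq_vecI) auto
      then show False using w(2) by contradiction
    qed
    then obtain i where i: "i < ?n" "w $ i \<noteq> 0" by blast
    then have "\<exists>v\<in>set vs. x v \<noteq> 0" by (intro bexI[of _ "vs ! i"]) (simp_all add: xi)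
    moreover have "(\<Sum>v | v \<in> set vs \<and> (u, v) \<in> parcs G. x v) = k * x u" if u: "u \<in> set vs" for u
    proof -
      obtain i where i: "i < ?n" "u = vs ! i" using u unfolding in_set_conv_nth by blast
      have "(\<Sum>v | v \<in> set vs \<and> (u, v) \<in> parcs G. x v) = (?A *\<^sub>v w) $ i"
        unfolding i(2) entry[OF i(1), of x, symmetric] wx[symmetric] ..
      also have "\<dots> = k * x u" unfolding w(3) i(2) using w(1) i(1) by (simp add: xi)
      finally show ?thesis .
    qed
    ultimately show ?R by blast
  next
    assume ?R
    then obtain x where x: "\<exists>v\<in>set vs. x v \<noteq> 0"
      "\<And>u. u \<in> set vs \<Longrightarrow> (\<Sum>v | v \<in> set vs \<and> (u, v) \<in> parcs G. x v) = k * x u" by blast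
    define w where "w = vec ?n (\<lambda>i. x (vs ! i))"
    obtain i where i: "i < ?n" "x (vs ! i) \<noteq> 0"
    proof -
      from x(1) obtain v where "v \<in> set vs" "x v \<noteq> 0" by blast
      then show thesis using that unfolding in_set_conv_nth by blast
    qed
    have "w \<noteq> 0\<^sub>v ?n"
    proof
      assume "w = 0\<^sub>v ?n"
      then have "w $ i = 0" using i(1) by simp
      then show False using i by (simp add: w_def)
    qed
    moreover have "?A *\<^sub>v w = k \<cdot>\<^sub>v w"
    proof (rule eq_vecI)
      fix j assume "j < dim_vec (k \<cdot>\<^sub>v w)"
      then have j: "j < ?n" by (simp add: w_def)
      show "(?A *\<^sub>v w) $ j = (k \<cdot>\<^sub>v w) $ j"
        unfolding w_def entry[OF j] x(2)[OF nth_mem[OF j]] using j by simp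
    qed (simp add: w_def dims)
    ultimately show ?L
      unfolding eigenvalue_def eigenvector_def dims by (intro exI[of _ w]) (auto simp: w_def)
  qed
qed

lemma spectrum_adj_matrix_cong:
  assumes "distinct vs" "distinct ws" "set vs = set ws"
  shows "spectrum (adj_matrix vs G) = spectrum (adj_matrix ws G)"
  unfolding spectrum_def eigenvalue_adj_matrix_iff[OF assms(1)]
    eigenvalue_adj_matrix_iff[OF assms(2)] assms(3) ..


section \<open>Cycles of an undirected graph\<close>

definition undirected_edges :: "('a \<times> 'a) awalk \<Rightarrow> 'a set set" where
  "undirected_edges p = (\<lambda>(u, v). {u, v}) ` set p"

text \<open>
  A cycle, as a subgraph, is identified with its set of undirected edges, so that neither the
  starting vertex nor the direction of traversal matters. \<^const>\<open>pre_digraph.cycle\<close> admits the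
  closed walk \<open>u, v, u\<close> along an edge and back, which is not a cycle of an undirected graph;
  the bound on the length excludes it.
\<close>

definition cycle_subgraphs :: "'a pair_pre_digraph \<Rightarrow> 'a set set set" where
  "cycle_subgraphs G =
     {undirected_edges p | p. pre_digraph.cycle (with_proj G) p \<and> 3 \<le> length p}"

definition has_two_cycles_of_same_length :: "'a pair_pre_digraph \<Rightarrow> bool" where
  "has_two_cycles_of_same_length G \<longleftrightarrow>
     (\<exists>C\<in>cycle_subgraphs G. \<exists>D\<in>cycle_subgraphs G. C \<noteq> D \<and> card C = card D)"


section \<open>The star with an additional edge\<close>

definition complete_bipartite :: "nat \<Rightarrow> nat \<Rightarrow> nat pair_pre_digraph" where
  "complete_bipartite a b =
     \<lparr> pverts = {..<a + b},
       parcs = {..<a} \<times> {a..<a + b} \<union> {a..<a + b} \<times> {..<a} \<rparr>"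

text \<open>
  The centre of the star \<open>complete_bipartite 1 (n - 1)\<close> is \<open>0\<close>, and the added edge joins the
  leaves \<open>1\<close> and \<open>2\<close>; this presupposes \<open>n \<ge> 3\<close>.
\<close>

definition star_plus :: "nat \<Rightarrow> nat pair_pre_digraph" where
  "star_plus n =
     \<lparr> pverts = pverts (complete_bipartite 1 (n - 1)),
       parcs = parcs (complete_bipartite 1 (n - 1)) \<union> {(1, 2), (2, 1)} \<rparr>"

lemma pair_graph_complete_bipartite: "pair_graph (complete_bipartite a b)"
  by unfold_locales (auto simp: complete_bipartite_def symmetric_def sym_def)

lemma complete_bipartite_digraph_complete_bipartite:
  "complete_bipartite_digraph a b (with_proj (complete_bipartite a b))"
proof -
  have "graph (with_proj (complete_bipartite a b))"
    by (rule pair_graph.pair_graphD_graph[OF pair_graph_complete_bipartite])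
  moreover have "\<exists>U V. {..<a + b} = U \<union> V \<and> U \<inter> V = {} \<and> card U = a \<and> card V = b \<and>
      {..<a} \<times> {a..<a + b} \<union> {a..<a + b} \<times> {..<a} = U \<times> V \<union> V \<times> U"
    by (rule exI[of _ "{..<a}"], rule exI[of _ "{a..<a + b}"]) auto
  ultimately show ?thesis
    by (simp add: complete_bipartite_digraph_def complete_bipartite_def)
qed

lemma pair_graph_star_plus:
  assumes "3 \<le> n"
  shows "pair_graph (star_plus n)"
  using assms
  by unfold_locales (auto simp: star_plus_def complete_bipartite_def symmetric_def sym_def)

lemma card_pverts_star_plus:
  assumes "1 \<le> n"
  shows "card (pverts (star_plus n)) = n"
  using assms by (simp add: star_plus_def complete_bipartite_def)

end

theory Submission
  imports Defs
begin

text \<open>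
  Let \<open>k = \<rho>(G)\<close>, and scale an eigenvector \<open>x\<close> so that its entry of largest modulus is
  \<open>x u = 1\<close>. Let \<open>N\<close> be the neighbourhood of \<open>u\<close>, \<open>W\<close> the set of vertices at distance at least
  2 from \<open>u\<close>, and \<open>T\<close> the sum of \<open>\<bar>x w\<bar>\<close> over the \<open>w \<in> W\<close> with a neighbour in \<open>N\<close>. The
  eigenvalue equation at \<open>u\<close>, applied twice, reads \<open>k\<^sup>2 = \<bar>N\<bar> + P + S\<close>, where \<open>P\<close> comes from the edges
  inside \<open>N\<close> and \<open>S\<close> from those between \<open>N\<close> and \<open>W\<close>. As there is at most one triangle and at most
  one 4-cycle, \<open>(k - 1) P \<le> 2 + T\<close> and \<open>S \<le> T + \<xi>\<close>, where \<open>\<xi> \<le> 1\<close> is the contribution of the one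
  vertex of \<open>W\<close> that may have two neighbours in \<open>N\<close>. The spectral radius \<open>c\<close> of the star with an
  additional edge satisfies \<open>(c - 1) (c\<^sup>2 - (n - 1)) = 2\<close>, so \<open>k \<ge> c\<close> gives
  \<open>(k - 1) \<bar>W\<bar> \<le> k T + (k - 1) \<xi>\<close>.

  At most one cycle of each of the lengths 3, 4, 5, 6 also means that at most \<open>\<bar>W\<bar> + 7\<close> arcs
  leave the vertices counted in \<open>T\<close>, whence \<open>k T \<le> \<bar>W\<bar> + 7\<close>. Since \<open>k \<ge> 5\<close> for \<open>n \<ge> 26\<close>, this
  forces \<open>\<bar>W\<bar> \<le> 3\<close>; then \<open>\<bar>x w\<bar> \<le> 1/3\<close> on \<open>W\<close>, and the same inequality forces \<open>W\<close> to be empty.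
  So \<open>G\<close> is a star with at most one additional edge.
\<close>

section \<open>Real symmetric matrices\<close>

text \<open>Over the complex numbers some eigenvalue \<open>c\<close> exists. For its eigenvector
  \<open>z\<close> the form \<open>Q\<close> is real by symmetry and equals \<open>c\<close> times
  the positive \<open>R\<close>. So \<open>c\<close> is real, and the real or the imaginary part of
  \<open>z\<close> is a real eigenvector.\<close>

lemma spectrum_symmetric_nonempty:
  fixes A :: "real mat"
  assumes A: "A \<in> carrier_mat n n" and n: "n > 0"
    and sym: "\<And>i j. i < n \<Longrightarrow> j < n \<Longrightarrow> A $$ (i, j) = A $$ (j, i)"
  shows "spectrum A \<noteq> {}"
proof -
  define B where "B = map_mat complex_of_real A"
  have B: "B \<in> carrier_mat n n" using A by (simp add: B_def)
  from spectrum_non_empty[OF B n] obtain c where "eigenvalue B c"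
    by (auto simp: spectrum_def)
  then obtain w where w: "w \<in> carrier_vec n" "w \<noteq> 0\<^sub>v n" "B *\<^sub>v w = c \<cdot>\<^sub>v w"
    using B by (auto simp: eigenvalue_def eigenvector_def)
  define z where "z i = w $ i" for i
  define a where "a i j = A $$ (i, j)" for i j
  have eq: "(\<Sum>j<n. of_real (a i j) * z j) = c * z i" if "i < n" for i
  proof -
    have "(B *\<^sub>v w) $ i = (\<Sum>j<n. of_real (a i j) * z j)"
      using that w(1) A
      by (auto simp: B_def a_def z_def scalar_prod_def atLeast0LessThan intro!: sum.cong)
    then show ?thesis using w that by (auto simp: z_def)
  qed
  obtain i0 where i0: "i0 < n" "z i0 \<noteq> 0"
  proof (rule ccontr)
    assume "\<not> thesis"
    then have "w = 0\<^sub>v n" using w(1) that by (intro eq_vecI) (auto simp: z_def)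
    with w(2) show False by simp
  qed
  define Q where "Q = (\<Sum>i<n. \<Sum>j<n. of_real (a i j) * (cnj (z i) * z j))"
  define R where "R = (\<Sum>i<n. (cmod (z i))\<^sup>2)"
  have "Q = (\<Sum>i<n. cnj (z i) * (\<Sum>j<n. of_real (a i j) * z j))"
    by (simp add: Q_def sum_distrib_left mult_ac)
  also have "\<dots> = (\<Sum>i<n. c * of_real ((cmod (z i))\<^sup>2))"
  proof (rule sum.cong)
    fix i assume "i \<in> {..<n}"
    then show "cnj (z i) * (\<Sum>j<n. of_real (a i j) * z j) = c * of_real ((cmod (z i))\<^sup>2)"
      unfolding complex_norm_square by (simp only: eq lessThan_iff) (simp add: mult_ac)
  qed simp
  finally have QR: "Q = c * of_real R" by (simp add: R_def sum_distrib_left)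
  have "cnj Q = (\<Sum>i<n. \<Sum>j<n. of_real (a j i) * (cnj (z j) * z i))"
    using sym by (auto simp: Q_def a_def mult_ac intro!: sum.cong)
  also have "\<dots> = Q" unfolding Q_def by (rule sum.swap)
  finally have "Im (cnj Q) = Im Q" by simp
  then have "Im Q = 0" by simp
  moreover have "R > 0"
    unfolding R_def using i0 by (intro sum_pos2[of _ i0]) auto
  ultimately have "Im c = 0" by (simp add: QR)
  then have c: "c = of_real (Re c)" by (simp add: complex_eq_iff)
  have ev: "eigenvalue A (Re c)"
    if f: "\<And>i. i < n \<Longrightarrow> (\<Sum>j<n. a i j * f j) = Re c * f i" and i: "i < n" "f i \<noteq> 0" for f i
  proof -
    let ?w = "vec n f"
    have "?w \<noteq> 0\<^sub>v n"
    proof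
      assume "?w = 0\<^sub>v n"
      then have "?w $ i = 0" using i by simp
      with i show False by simp
    qed
    moreover have "A *\<^sub>v ?w = Re c \<cdot>\<^sub>v ?w"
      using A f by (intro eq_vecI)
        (auto simp: scalar_prod_def atLeast0LessThan a_def)
    ultimately show ?thesis
      using A unfolding eigenvalue_def eigenvector_def by (intro exI[of _ ?w]) auto
  qed
  have re: "(\<Sum>j<n. a i j * Re (z j)) = Re c * Re (z i)" if "i < n" for i
    using arg_cong[OF eq[OF that], of Re] \<open>Im c = 0\<close> by simp
  have im: "(\<Sum>j<n. a i j * Im (z j)) = Re c * Im (z i)" if "i < n" for i
    using arg_cong[OF eq[OF that], of Im] \<open>Im c = 0\<close> by simp
  have "Re (z i0) \<noteq> 0 \<or> Im (z i0) \<noteq> 0" using i0 by (simp add: complex_eq_iff)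
  then have "eigenvalue A (Re c)"
    using ev[of "\<lambda>j. Re (z j)", OF re i0(1)] ev[of "\<lambda>j. Im (z j)", OF im i0(1)] by auto
  then show ?thesis by (auto simp: spectrum_def)
qed


section \<open>Spectral radii of graphs\<close>

context
  fixes G :: "'a pair_pre_digraph"
  assumes G: "pair_graph G"
begin

interpretation pair_graph G by (rule G)

lemma finite_spectrum_adjacency: "finite (spectrum (adjacency_matrix G))"
  by (rule card_finite_spectrum(1)[of _ "length (vertex_list G)"])
    (simp add: adjacency_matrix_def adj_matrix_def)

lemma eigenvalue_adjacency_iff:
  "k \<in> spectrum (adjacency_matrix G) \<longleftrightarrow>
    (\<exists>x. (\<exists>v\<in>pverts G. x v \<noteq> 0) \<and>
         (\<forall>u\<in>pverts G. (\<Sum>v | (u, v) \<in> parcs G. x v) = k * x u))"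
proof -
  have "{v. v \<in> pverts G \<and> (u, v) \<in> parcs G} = {v. (u, v) \<in> parcs G}" for u
    using in_arcsD2 by auto
  then show ?thesis
    using eigenvalue_adj_matrix_iff[OF vertex_list(1)[OF pair_finite_verts], of G k]
    by (simp add: vertex_list(2)[OF pair_finite_verts] spectrum_def adjacency_matrix_def)
qed

text \<open>Symmetry of adjacency makes the spectrum nonempty, so the \<open>Max\<close> in the
  definition is attained.\<close>

lemma graph_spectral_radius_in_spectrum:
  assumes "pverts G \<noteq> {}"
  shows "graph_spectral_radius G \<in> spectrum (adjacency_matrix G)"
  unfolding graph_spectral_radius_def
proof (rule Max_in[OF finite_spectrum_adjacency])
  have "vertex_list G \<noteq> []"
    using assms vertex_list(2)[OF pair_finite_verts] by auto
  moreover have "(a, b) \<in> parcs G \<longleftrightarrow> (b, a) \<in> parcs G" for a b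
    using pair_sym_arcs by (auto simp: symmetric_def sym_def)
  ultimately show "spectrum (adjacency_matrix G) \<noteq> {}"
    by (intro spectrum_symmetric_nonempty[of _ "length (vertex_list G)"])
      (auto simp: adjacency_matrix_def adj_matrix_def)
qed

lemma graph_spectral_radius_ge:
  "k \<in> spectrum (adjacency_matrix G) \<Longrightarrow> k \<le> graph_spectral_radius G"
  unfolding graph_spectral_radius_def by (rule Max_ge[OF finite_spectrum_adjacency])

end

text \<open>The comparison with \<open>G\<close> asks for a lower bound, so any eigenvalue serves:
  the intermediate value theorem yields a root of the equation, and an explicit eigenvector shows
  that it is an eigenvalue.\<close>

lemma graph_spectral_radius_star_plus:
  assumes n: "n \<ge> 26"
  obtains k where "k \<ge> 5" "(k - 1) * (k\<^sup>2 - (real n - 1)) = 2"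
    "k \<le> graph_spectral_radius (star_plus n)"
proof -
  define f where "f t = (t - 1) * (t\<^sup>2 - (real n - 1))" for t :: real
  have "\<exists>k. 5 \<le> k \<and> k \<le> real n \<and> f k = 2"
  proof (rule IVT)
    \<comment> \<open>The value is \<open>4 * (26 - n)\<close>: here \<open>n \<ge> 26\<close>
      places the root at or above 5.\<close>
    show "f 5 \<le> 2" using n by (simp add: f_def)
    have "(real n - 1) * 2 \<le> f (real n)"
      unfolding f_def using n by (intro mult_left_mono)
        (auto simp: power2_eq_square algebra_simps
          intro: order_trans[OF _ mult_right_mono[of 26 "real n"]])
    then show "2 \<le> f (real n)" using n by simp
    show "\<forall>t. 5 \<le> t \<and> t \<le> real n \<longrightarrow> isCont f t"
      unfolding f_def by (auto intro!: continuous_intros)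
  qed (use n in simp)
  then obtain k where k: "5 \<le> k" "f k = 2" by blast
  \<comment> \<open>With entry 1 at the centre, the equations at the leaves force
    \<open>1 / (k - 1)\<close> on the two adjacent leaves and \<open>1 / k\<close> on the others.
    The equation at the centre then amounts to \<open>f k = 2\<close>.\<close>
  define x :: "nat \<Rightarrow> real" where
    "x v = (if v = 0 then 1 else if v < 3 then 1 / (k - 1) else 1 / k)" for v
  have P: "pair_graph (star_plus n)" using n by (intro pair_graph_star_plus) simp
  have arcs: "{v. (u, v) \<in> parcs (star_plus n)} =
      (if u = 0 then {1..<n} else if u = 1 then {0, 2} else if u = 2 then {0, 1} else {0})"
    if "u < n" for u
    using that n by (auto simp: star_plus_def complete_bipartite_def)
  have "(\<Sum>v | (u, v) \<in> parcs (star_plus n). x v) = k * x u" if u: "u < n" for u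
  proof -
    consider "u = 0" | "u = 1" | "u = 2" | "u \<ge> 3" by linarith
    then show ?thesis
    proof cases
      case 1
      have "{1..<n} = insert 1 (insert 2 {3..<n})" using n by auto
      then have "(\<Sum>v | (u, v) \<in> parcs (star_plus n). x v) = 2 / (k - 1) + (\<Sum>v\<in>{3..<n}. x v)"
        using 1 arcs[OF u] k(1) by (simp add: x_def)
      also have "(\<Sum>v\<in>{3..<n}. x v) = (\<Sum>v\<in>{3..<n}. 1 / k)"
        by (intro sum.cong) (auto simp: x_def)
      also have "\<dots> = (real n - 3) / k" using n by (simp add: of_nat_diff)
      also have "2 / (k - 1) + (real n - 3) / k = k"
        using k by (simp add: f_def field_simps power2_eq_square)
      finally show ?thesis using 1 by (simp add: x_def)
    qed (use arcs[OF u] k(1) in \<open>auto simp: x_def field_simps\<close>)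
  qed
  moreover have "pverts (star_plus n) = {..<n}"
    using n by (auto simp: star_plus_def complete_bipartite_def)
  ultimately have "k \<in> spectrum (adjacency_matrix (star_plus n))"
    using n unfolding eigenvalue_adjacency_iff[OF P]
    by (intro exI[of _ x]) (auto simp: x_def intro: bexI[of _ 0])
  with k show ?thesis
    using that[of k] graph_spectral_radius_ge[OF P] by (simp add: f_def)
qed


section \<open>Graphs without two cycles of the same length\<close>

text \<open>Here and in the next three lemmas, distinct vertices make the listed edges distinct.
  Their number is recorded because cycles are compared by it.\<close>

lemma cycle_subgraphs_3:
  assumes "(a, b) \<in> parcs G" "(b, c) \<in> parcs G" "(c, a) \<in> parcs G"
    and "distinct [a, b, c]" "a \<in> pverts G"
  shows "{{a, b}, {b, c}, {c, a}} \<in> cycle_subgraphs G" "card {{a, b}, {b, c}, {c, a}} = 3"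
proof -
  interpret pair_pre_digraph G .
  show "{{a, b}, {b, c}, {c, a}} \<in> cycle_subgraphs G"
    unfolding cycle_subgraphs_def using assms
    by (intro CollectI exI[of _ "[(a, b), (b, c), (c, a)]"])
      (auto simp: undirected_edges_def cycle_def awalk_def)
qed (use assms in \<open>auto simp: doubleton_eq_iff card_insert_if\<close>)

lemma cycle_subgraphs_4:
  assumes "(a, b) \<in> parcs G" "(b, c) \<in> parcs G" "(c, d) \<in> parcs G" "(d, a) \<in> parcs G"
    and "distinct [a, b, c, d]" "a \<in> pverts G"
  shows "{{a, b}, {b, c}, {c, d}, {d, a}} \<in> cycle_subgraphs G"
    "card {{a, b}, {b, c}, {c, d}, {d, a}} = 4"
proof -
  interpret pair_pre_digraph G .
  show "{{a, b}, {b, c}, {c, d}, {d, a}} \<in> cycle_subgraphs G"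
    unfolding cycle_subgraphs_def using assms
    by (intro CollectI exI[of _ "[(a, b), (b, c), (c, d), (d, a)]"])
      (auto simp: undirected_edges_def cycle_def awalk_def)
qed (use assms in \<open>auto simp: doubleton_eq_iff card_insert_if\<close>)

lemma cycle_subgraphs_5:
  assumes "(a, b) \<in> parcs G" "(b, c) \<in> parcs G" "(c, d) \<in> parcs G" "(d, e) \<in> parcs G"
    "(e, a) \<in> parcs G"
    and "distinct [a, b, c, d, e]" "a \<in> pverts G"
  shows "{{a, b}, {b, c}, {c, d}, {d, e}, {e, a}} \<in> cycle_subgraphs G"
    "card {{a, b}, {b, c}, {c, d}, {d, e}, {e, a}} = 5"
proof -
  interpret pair_pre_digraph G .
  show "{{a, b}, {b, c}, {c, d}, {d, e}, {e, a}} \<in> cycle_subgraphs G"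
    unfolding cycle_subgraphs_def using assms
    by (intro CollectI exI[of _ "[(a, b), (b, c), (c, d), (d, e), (e, a)]"])
      (auto simp: undirected_edges_def cycle_def awalk_def)
qed (use assms in \<open>auto simp: doubleton_eq_iff card_insert_if\<close>)

lemma cycle_subgraphs_6:
  assumes "(a, b) \<in> parcs G" "(b, c) \<in> parcs G" "(c, d) \<in> parcs G" "(d, e) \<in> parcs G"
    "(e, f) \<in> parcs G" "(f, a) \<in> parcs G"
    and "distinct [a, b, c, d, e, f]" "a \<in> pverts G"
  shows "{{a, b}, {b, c}, {c, d}, {d, e}, {e, f}, {f, a}} \<in> cycle_subgraphs G"
    "card {{a, b}, {b, c}, {c, d}, {d, e}, {e, f}, {f, a}} = 6"
proof -
  interpret pair_pre_digraph G .
  show "{{a, b}, {b, c}, {c, d}, {d, e}, {e, f}, {f, a}} \<in> cycle_subgraphs G"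
    unfolding cycle_subgraphs_def using assms
    by (intro CollectI exI[of _ "[(a, b), (b, c), (c, d), (d, e), (e, f), (f, a)]"])
      (auto simp: undirected_edges_def cycle_def awalk_def)
qed (use assms in \<open>auto simp: doubleton_eq_iff card_insert_if\<close>)

locale distinct_cycle_lengths = pair_graph G for G :: "'a pair_pre_digraph" +
  assumes no_two_cycles: "\<not> has_two_cycles_of_same_length G"
begin

lemma cycle_unique:
  "C \<in> cycle_subgraphs G \<Longrightarrow> D \<in> cycle_subgraphs G \<Longrightarrow> card C = card D \<Longrightarrow> C = D"
  using no_two_cycles unfolding has_two_cycles_of_same_length_def by blast

lemma adj_sym: "(a, b) \<in> parcs G \<Longrightarrow> (b, a) \<in> parcs G"
  using pair_sym_arcs by (auto simp: symmetric_def sym_def)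

lemma adj_irrefl: "(a, a) \<notin> parcs G"
  using pair_no_loops by force

abbreviation nb :: "'a \<Rightarrow> 'a set" where
  "nb v \<equiv> {z. (v, z) \<in> parcs G}"

lemma nb_subset: "nb v \<subseteq> pverts G"
  using in_arcsD2 by auto

lemma finite_nb: "finite (nb v)"
  using finite_subset[OF nb_subset pair_finite_verts] .

end

section \<open>The layers around a vertex\<close>

locale rooted_distinct_cycle_lengths = distinct_cycle_lengths +
  fixes u :: 'a
  assumes root: "u \<in> pverts G"
begin

text \<open>The graph may be disconnected: \<open>W1\<close> is the sphere of radius 2 around
  \<open>u\<close>, while \<open>W0\<close> holds the vertices at distance 3 or more together with
  all other components.\<close>

definition W :: "'a set" where "W = pverts G - nb u - {u}"
definition W1 :: "'a set" where "W1 = {w \<in> W. nb w \<inter> nb u \<noteq> {}}"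
definition W0 :: "'a set" where "W0 = W - W1"

text \<open>
  \<open>parent\<close> and \<open>child\<close> are arbitrary choices, meaningful only for vertices of
  \<open>W1\<close> and for vertices with a neighbour in \<open>W1\<close>, respectively.
\<close>

definition parent :: "'a \<Rightarrow> 'a" where "parent w = (SOME v. v \<in> nb w \<inter> nb u)"
definition child :: "'a \<Rightarrow> 'a" where "child y = (SOME w. w \<in> nb y \<inter> W1)"

lemma finite_layers: "finite W" "finite W1" "finite W0"
  using pair_finite_verts by (auto simp: W_def W1_def W0_def)

lemma root_notin: "u \<notin> nb u" "u \<notin> W"
  using adj_irrefl by (auto simp: W_def)

lemma layers_disjoint: "nb u \<inter> W = {}" "W1 \<inter> W0 = {}" "W1 \<subseteq> W" "W0 \<subseteq> W"
  by (auto simp: W_def W1_def W0_def)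

lemma layerD:
  "(u, v) \<in> parcs G \<Longrightarrow> v \<noteq> u \<and> v \<notin> W \<and> v \<notin> W1 \<and> v \<notin> W0"
  "w \<in> W1 \<Longrightarrow> w \<noteq> u \<and> w \<in> W \<and> w \<notin> W0 \<and> (u, w) \<notin> parcs G"
  "w \<in> W0 \<Longrightarrow> w \<noteq> u \<and> w \<in> W \<and> w \<notin> W1 \<and> (u, w) \<notin> parcs G"
  using root_notin layers_disjoint by auto

lemma vertices_layers: "pverts G = insert u (nb u \<union> W)"
  using root nb_subset[of u] by (auto simp: W_def)

lemma parent: "w \<in> W1 \<Longrightarrow> (u, parent w) \<in> parcs G" "w \<in> W1 \<Longrightarrow> (w, parent w) \<in> parcs G"
  using someI_ex[of "\<lambda>v. v \<in> nb w \<inter> nb u"] by (auto simp: parent_def W1_def)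

text \<open>For \<open>y\<close> in \<open>W0\<close> the child is one layer closer to the root, so
  \<open>y\<close>, \<open>child y\<close>, \<open>parent (child y)\<close>, \<open>u\<close> is a
  path.\<close>

lemma child:
  assumes "w \<in> W1" "(w, y) \<in> parcs G"
  shows "child y \<in> W1" "(y, child y) \<in> parcs G"
  using someI[of "\<lambda>w. w \<in> nb y \<inter> W1" w] assms by (auto simp: child_def intro: adj_sym)

definition nb_edges :: "('a \<times> 'a) set" where
  "nb_edges = {(a, b). a \<in> nb u \<and> b \<in> nb u \<and> (a, b) \<in> parcs G}"

definition extra_parents :: "('a \<times> 'a) set" where
  "extra_parents = {(w, v). w \<in> W1 \<and> v \<in> nb u \<and> (w, v) \<in> parcs G \<and> v \<noteq> parent w}"

definition siblings :: "('a \<times> 'a) set" where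
  "siblings = {(w, z). w \<in> W1 \<and> z \<in> W1 \<and> (w, z) \<in> parcs G \<and> parent w = parent z}"

definition cousins :: "('a \<times> 'a) set" where
  "cousins = {(w, z). w \<in> W1 \<and> z \<in> W1 \<and> (w, z) \<in> parcs G \<and> parent w \<noteq> parent z}"

definition sibling_edges :: "('a \<times> 'a) set" where
  "sibling_edges = {(w, y). w \<in> W1 \<and> y \<in> W0 \<and> (w, y) \<in> parcs G \<and> w \<noteq> child y \<and>
     parent w = parent (child y)}"

definition cousin_edges :: "('a \<times> 'a) set" where
  "cousin_edges = {(w, y). w \<in> W1 \<and> y \<in> W0 \<and> (w, y) \<in> parcs G \<and> w \<noteq> child y \<and>
     parent w \<noteq> parent (child y)}"

text \<open>
  An arc in one of these six sets closes a cycle of fixed length through \<open>u\<close> or through a common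
  parent. Apart from arcs to chosen parents and children, it is the only arc of that cycle joining
  its two layers. Hence the uniqueness of the cycle yields that of the arc, up to its orientation
  if both ends lie in the same layer.
\<close>

lemma nb_edges_unique:
  assumes "(a, b) \<in> nb_edges" "(c, d) \<in> nb_edges"
  shows "{c, d} = {a, b}"
proof -
  let ?C = "\<lambda>s t. {{u, s}, {s, t}, {t, u}}"
  have cyc: "?C s t \<in> cycle_subgraphs G" "card (?C s t) = 3" if e: "(s, t) \<in> nb_edges" for s t
  proof -
    note facts = e  root in_arcsD2[of u]
    have "distinct [u, s, t]" "u \<in> pverts G"
      using facts by (simp_all add: nb_edges_def) (metis layerD adj_irrefl)+
    moreover have "(u, s) \<in> parcs G" "(s, t) \<in> parcs G" "(t, u) \<in> parcs G"
      using facts by (auto simp: nb_edges_def intro: adj_sym)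
    ultimately show "?C s t \<in> cycle_subgraphs G" "card (?C s t) = 3"
      by - (rule cycle_subgraphs_3; assumption)+
  qed
  have "?C a b = ?C c d"
    using assms by (intro cycle_unique) (simp_all only: cyc)
  then have "{c, d} \<in> ?C a b" by simp
  then show ?thesis
    using assms 
    by (auto simp: nb_edges_def doubleton_eq_iff dest: layerD)
qed

lemma extra_parents_unique:
  assumes "(a, b) \<in> extra_parents" "(c, d) \<in> extra_parents"
  shows "(c, d) = (a, b)"
proof -
  let ?C = "\<lambda>w v. {{u, parent w}, {parent w, w}, {w, v}, {v, u}}"
  have cyc: "?C w v \<in> cycle_subgraphs G" "card (?C w v) = 4"
     if e: "(w, v) \<in> extra_parents" for w v
  proof -
    note facts = e parent[of w] root in_arcsD2[of u]
    have "distinct [u, parent w, w, v]" "u \<in> pverts G"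
      using facts by (simp_all add: extra_parents_def) (metis layerD adj_irrefl)+
    moreover have "(u, parent w) \<in> parcs G" "(parent w, w) \<in> parcs G"
        "(w, v) \<in> parcs G" "(v, u) \<in> parcs G"
      using facts by (auto simp: extra_parents_def intro: adj_sym)
    ultimately show "?C w v \<in> cycle_subgraphs G" "card (?C w v) = 4"
      by - (rule cycle_subgraphs_4; assumption)+
  qed
  have "?C a b = ?C c d"
    using assms by (intro cycle_unique) (simp_all only: cyc)
  \<comment> \<open>Only \<open>{parent a, a}\<close> and \<open>{a, b}\<close> in this cycle join
    \<open>nb u\<close> to \<open>W1\<close>. The former is excluded because \<open>d\<close> is not
    the chosen parent of \<open>c\<close>.\<close>
  then have "{c, d} \<in> ?C a b" by simp
  then show ?thesis
    using assms parent[of "a"] parent[of c]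
    by (auto simp: extra_parents_def doubleton_eq_iff dest: layerD)
qed

lemma siblings_unique:
  assumes "(a, b) \<in> siblings" "(c, d) \<in> siblings"
  shows "{c, d} = {a, b}"
proof -
  let ?C = "\<lambda>s t. {{parent s, s}, {s, t}, {t, parent s}}"
  have cyc: "?C s t \<in> cycle_subgraphs G" "card (?C s t) = 3" if e: "(s, t) \<in> siblings" for s t
  proof -
    note facts = e parent[of s] parent[of t] root in_arcsD2[of u]
    have "distinct [parent s, s, t]" "parent s \<in> pverts G"
      using facts by (simp_all add: siblings_def) (metis layerD adj_irrefl)+
    moreover have "(parent s, s) \<in> parcs G" "(s, t) \<in> parcs G" "(t, parent s) \<in> parcs G"
      using facts by (auto simp: siblings_def intro: adj_sym)
    ultimately show "?C s t \<in> cycle_subgraphs G" "card (?C s t) = 3"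
      by - (rule cycle_subgraphs_3; assumption)+
  qed
  have "?C a b = ?C c d"
    using assms by (intro cycle_unique) (simp_all only: cyc)
  then have "{c, d} \<in> ?C a b" by simp
  then show ?thesis
    using assms parent[of "a"] parent[of "b"]
    by (auto simp: siblings_def doubleton_eq_iff dest: layerD)
qed

lemma cousins_unique:
  assumes "(a, b) \<in> cousins" "(c, d) \<in> cousins"
  shows "{c, d} = {a, b}"
proof -
  let ?C = "\<lambda>s t. {{u, parent s}, {parent s, s}, {s, t}, {t, parent t}, {parent t, u}}"
  have cyc: "?C s t \<in> cycle_subgraphs G" "card (?C s t) = 5" if e: "(s, t) \<in> cousins" for s t
  proof -
    note facts = e parent[of s] parent[of t] root in_arcsD2[of u]
    have "distinct [u, parent s, s, t, parent t]" "u \<in> pverts G"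
      using facts by (simp_all add: cousins_def) (metis layerD adj_irrefl)+
    moreover have "(u, parent s) \<in> parcs G" "(parent s, s) \<in> parcs G"
        "(s, t) \<in> parcs G" "(t, parent t) \<in> parcs G" "(parent t, u) \<in> parcs G"
      using facts by (auto simp: cousins_def intro: adj_sym)
    ultimately show "?C s t \<in> cycle_subgraphs G" "card (?C s t) = 5"
      by - (rule cycle_subgraphs_5; assumption)+
  qed
  have "?C a b = ?C c d"
    using assms by (intro cycle_unique) (simp_all only: cyc)
  then have "{c, d} \<in> ?C a b" by simp
  then show ?thesis
    using assms parent[of "a"] parent[of "b"]
    by (auto simp: cousins_def doubleton_eq_iff dest: layerD)
qed

lemma sibling_edges_unique:
  assumes "(a, b) \<in> sibling_edges" "(c, d) \<in> sibling_edges"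
  shows "(c, d) = (a, b)"
proof -
  let ?C = "\<lambda>w y. {{parent w, w}, {w, y}, {y, child y}, {child y, parent w}}"
  have ch: "child y \<in> W1" "(y, child y) \<in> parcs G" if "(w, y) \<in> sibling_edges" for w y
    using that child[of w y] by (auto simp: sibling_edges_def)
  have cyc: "?C w y \<in> cycle_subgraphs G" "card (?C w y) = 4"
     if e: "(w, y) \<in> sibling_edges" for w y
  proof -
    note facts = e ch[OF e] parent[of w] parent[of "child y"] root in_arcsD2[of u]
    have "distinct [parent w, w, y, child y]" "parent w \<in> pverts G"
      using facts by (simp_all add: sibling_edges_def) (metis layerD adj_irrefl)+
    moreover have "(parent w, w) \<in> parcs G" "(w, y) \<in> parcs G" "(y, child y) \<in> parcs G"
        "(child y, parent w) \<in> parcs G"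
      using facts by (auto simp: sibling_edges_def intro: adj_sym)
    ultimately show "?C w y \<in> cycle_subgraphs G" "card (?C w y) = 4"
      by - (rule cycle_subgraphs_4; assumption)+
  qed
  have "?C a b = ?C c d"
    using assms by (intro cycle_unique) (simp_all only: cyc)
  then have "{c, d} \<in> ?C a b" by simp
  then show ?thesis
    using assms ch[OF assms(1)] parent[of "a"] parent[of "child b"]
    by (auto simp: sibling_edges_def doubleton_eq_iff dest: layerD)
qed

lemma cousin_edges_unique:
  assumes "(a, b) \<in> cousin_edges" "(c, d) \<in> cousin_edges"
  shows "(c, d) = (a, b)"
proof -
  let ?C = "\<lambda>w y. {{u, parent w}, {parent w, w}, {w, y}, {y, child y}, {child y,
    parent (child y)}, {parent (child y), u}}"
  have ch: "child y \<in> W1" "(y, child y) \<in> parcs G" if "(w, y) \<in> cousin_edges" for w y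
    using that child[of w y] by (auto simp: cousin_edges_def)
  have cyc: "?C w y \<in> cycle_subgraphs G" "card (?C w y) = 6"
     if e: "(w, y) \<in> cousin_edges" for w y
  proof -
    note facts = e ch[OF e] parent[of w] parent[of "child y"] root in_arcsD2[of u]
    have "distinct [u, parent w, w, y, child y, parent (child y)]" "u \<in> pverts G"
      using facts by (simp_all add: cousin_edges_def) (metis layerD adj_irrefl)+
    moreover have "(u, parent w) \<in> parcs G" "(parent w, w) \<in> parcs G"
        "(w, y) \<in> parcs G" "(y, child y) \<in> parcs G"
        "(child y, parent (child y)) \<in> parcs G" "(parent (child y), u) \<in> parcs G"
      using facts by (auto simp: cousin_edges_def intro: adj_sym)
    ultimately show "?C w y \<in> cycle_subgraphs G" "card (?C w y) = 6"
      by - (rule cycle_subgraphs_6; assumption)+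
  qed
  have "?C a b = ?C c d"
    using assms by (intro cycle_unique) (simp_all only: cyc)
  then have "{c, d} \<in> ?C a b" by simp
  then show ?thesis
    using assms ch[OF assms(1)] parent[of "a"] parent[of "child b"]
    by (auto simp: cousin_edges_def doubleton_eq_iff dest: layerD)
qed

end

lemma card_le_1_if_unique:
  assumes "\<And>s t. s \<in> S \<Longrightarrow> t \<in> S \<Longrightarrow> s = t"
  shows "card S \<le> 1"
proof (cases "S = {}")
  case False
  then obtain s where "s \<in> S" by blast
  with assms have "S = {s}" by blast
  then show ?thesis by simp
qed simp

text \<open>An edge inside one layer contributes both of its orientations.\<close>

lemma card_le_2_if_unordered_unique:
  assumes "\<And>a b c d. (a, b) \<in> S \<Longrightarrow> (c, d) \<in> S \<Longrightarrow> {c, d} = {a, b}"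
  shows "card S \<le> 2"
proof (cases "S = {}")
  case False
  then obtain a b where "(a, b) \<in> S" by auto
  then have "S \<subseteq> {(a, b), (b, a)}"
    using assms[of a b] by (auto simp: doubleton_eq_iff)
  then have "card S \<le> card (set [(a, b), (b, a)])" by (intro card_mono) auto
  also have "\<dots> \<le> length [(a, b), (b, a)]" by (rule card_length)
  finally show ?thesis by simp
qed simp

section \<open>An eigenvector with its largest entry at the root\<close>

text \<open>The eigenvector may have entries of either sign, which avoids Perron-Frobenius and is
  why moduli are estimated. \<open>k_ge_star_plus\<close> is the comparison with the star, whose
  root gives equality.\<close>

locale rooted_eigenvector = rooted_distinct_cycle_lengths +
  fixes x :: "'a \<Rightarrow> real" and k :: real
  assumes eigen: "v \<in> pverts G \<Longrightarrow> (\<Sum>z\<in>nb v. x z) = k * x v"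
    and x_root: "x u = 1"
    and x_le: "v \<in> pverts G \<Longrightarrow> \<bar>x v\<bar> \<le> 1"
    and k_ge_5: "k \<ge> 5"
    and k_ge_star_plus: "(k - 1) * (k\<^sup>2 - (real (card (pverts G)) - 1)) \<ge> 2"
begin

definition T :: real where "T = (\<Sum>w\<in>W1. \<bar>x w\<bar>)"
definition \<xi> :: real where "\<xi> = (\<Sum>(w, v)\<in>extra_parents. \<bar>x w\<bar>)"

lemma card_extra_parents: "card extra_parents \<le> 1"
  by (rule card_le_1_if_unique) (metis extra_parents_unique surj_pair)

lemma finite_arc_sets: "S \<subseteq> parcs G \<Longrightarrow> finite S"
  using pair_finite_arcs by (rule finite_subset[rotated])

lemma finite_extra_parents: "finite extra_parents"
  by (rule finite_arc_sets) (auto simp: extra_parents_def)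

lemma eigen_abs_le: "v \<in> pverts G \<Longrightarrow> k * \<bar>x v\<bar> \<le> (\<Sum>z\<in>nb v. \<bar>x z\<bar>)"
  using eigen[of v] sum_abs[of x "nb v"] k_ge_5 by (simp add: abs_mult)

section \<open>Counting the arcs that leave \<open>W1\<close>\<close>

text \<open>A neighbour \<open>y\<close> of \<open>w\<close> lies in \<open>nb u\<close>,
  \<open>W1\<close> or \<open>W0\<close>. The cases split further by whether \<open>y\<close> is the
  chosen parent of \<open>w\<close>, whether \<open>w\<close> is the chosen child of
  \<open>y\<close>, and whether the parents agree.\<close>

lemma arcs_from_W1:
  "(SIGMA w:W1. nb w) \<subseteq>
    (\<lambda>w. (w, parent w)) ` W1 \<union> extra_parents \<union> siblings \<union> cousins \<union>
    (\<lambda>y. (child y, y)) ` W0 \<union> sibling_edges \<union> cousin_edges"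
proof -
  have "(w, y) \<in> (\<lambda>w. (w, parent w)) ` W1 \<union> extra_parents \<union> siblings \<union> cousins \<union>
    (\<lambda>y. (child y, y)) ` W0 \<union> sibling_edges \<union> cousin_edges"
    if wy: "w \<in> W1" "(w, y) \<in> parcs G" for w y
  proof -
    have "y \<noteq> u" using wy adj_sym[of w y] layerD(2)[of w] by blast
    then consider "y \<in> nb u" | "y \<in> W1" | "y \<in> W0"
      using in_arcsD2[OF wy(2)] by (auto simp: W0_def W_def)
    then show ?thesis
      using wy by cases (auto simp: extra_parents_def siblings_def cousins_def
          sibling_edges_def cousin_edges_def image_iff)
  qed
  then show ?thesis by auto
qed

text \<open>Chosen parents and children account for at most
  \<open>card W1 + card W0 = card W\<close> arcs, and the five exceptional sets for 1 + 2 + 2 + 1 +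
  1 = 7.\<close>

lemma card_arcs_from_W1: "card (SIGMA w:W1. nb w) \<le> card W + 7"
proof -
  let ?A = "(\<lambda>w. (w, parent w)) ` W1" and ?B = "(\<lambda>y. (child y, y)) ` W0"
  have fin: "finite siblings" "finite cousins" "finite sibling_edges" "finite cousin_edges"
    by (auto intro!: finite_arc_sets
        simp: siblings_def cousins_def sibling_edges_def cousin_edges_def)
  have c: "card siblings \<le> 2" "card cousins \<le> 2"
    by (rule card_le_2_if_unordered_unique[OF siblings_unique]
        card_le_2_if_unordered_unique[OF cousins_unique]; assumption)+
  have c': "card sibling_edges \<le> 1"
    by (rule card_le_1_if_unique) (metis sibling_edges_unique surj_pair)
  have c'': "card cousin_edges \<le> 1"
    by (rule card_le_1_if_unique) (metis cousin_edges_unique surj_pair)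
  have "card (SIGMA w:W1. nb w) \<le> card (?A \<union> extra_parents \<union> siblings \<union> cousins \<union> ?B \<union>
      sibling_edges \<union> cousin_edges)"
    using arcs_from_W1 fin finite_layers finite_extra_parents by (intro card_mono) auto
  also have "\<dots> \<le> card ?A + card extra_parents + card siblings + card cousins + card ?B +
      card sibling_edges + card cousin_edges"
    by (intro order_trans[OF card_Un_le] add_mono order_refl)
  also have "\<dots> \<le> card W1 + 1 + 2 + 2 + card W0 + 1 + 1"
    using c c' c'' card_extra_parents by (intro add_mono card_image_le finite_layers) auto
  also have "card W1 + card W0 = card W"
    using finite_layers layers_disjoint by (simp add: W0_def card_Diff_subset card_mono)
  then have "card W1 + 1 + 2 + 2 + card W0 + 1 + 1 = card W + 7" by simp
  finally show ?thesis .
qed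

text \<open>Summing the eigenvalue inequality over \<open>W1\<close> and bounding each entry by 1
  leaves the number of arcs.\<close>

lemma k_T_le: "k * T \<le> real (card W) + 7"
proof -
  have "k * T = (\<Sum>w\<in>W1. k * \<bar>x w\<bar>)" by (simp add: T_def sum_distrib_left)
  also have "\<dots> \<le> (\<Sum>w\<in>W1. \<Sum>z\<in>nb w. \<bar>x z\<bar>)"
    using layers_disjoint vertices_layers by (intro sum_mono eigen_abs_le) auto
  also have "\<dots> \<le> (\<Sum>w\<in>W1. \<Sum>z\<in>nb w. 1)"
    using x_le in_arcsD2 by (intro sum_mono) auto
  also have "\<dots> = real (card (SIGMA w:W1. nb w))"
    using finite_layers finite_nb by simp
  also have "\<dots> \<le> real (card W) + 7" using card_arcs_from_W1 by linarith
  finally show ?thesis .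
qed

text \<open>Applied with \<open>c = 1\<close> to bound \<open>card W\<close>, and with
  \<open>c = 1 / 3\<close> to show that \<open>W\<close> is empty.\<close>

lemma xi_le:
  assumes "\<And>w. w \<in> W \<Longrightarrow> \<bar>x w\<bar> \<le> c" "c \<ge> 0"
  shows "\<xi> \<le> c"
proof -
  have "\<xi> \<le> (\<Sum>(w, v)\<in>extra_parents. c)"
    unfolding \<xi>_def using assms(1) layers_disjoint
    by (intro sum_mono) (auto simp: extra_parents_def)
  also have "\<dots> = real (card extra_parents) * c" by simp
  also have "\<dots> \<le> 1 * c"
    using card_extra_parents assms(2) by (intro mult_right_mono) auto
  finally show ?thesis by simp
qed

section \<open>The eigenvalue equation at the root, applied twice\<close>

lemma sum_nb_split:
  fixes f :: "'a \<Rightarrow> real"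
  assumes "v \<in> nb u"
  shows "sum f (nb v) = f u + sum f (nb v \<inter> nb u) + sum f (nb v \<inter> W)"
proof -
  have "nb v = insert u ((nb v \<inter> nb u) \<union> (nb v \<inter> W))"
    using assms nb_subset[of v] vertices_layers adj_sym by blast
  then have "sum f (nb v) = sum f (insert u ((nb v \<inter> nb u) \<union> (nb v \<inter> W)))" by simp
  also have "\<dots> = f u + sum f ((nb v \<inter> nb u) \<union> (nb v \<inter> W))"
    using root_notin finite_nb by (intro sum.insert) auto
  also have "sum f ((nb v \<inter> nb u) \<union> (nb v \<inter> W)) = sum f (nb v \<inter> nb u) + sum f (nb v \<inter> W)"
    using finite_nb layers_disjoint by (intro sum.union_disjoint) auto
  finally show ?thesis by simp
qed

text \<open>Arcs from \<open>nb u\<close> to \<open>W\<close> end in \<open>W1\<close>. Those from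
  chosen parents meet each vertex of \<open>W1\<close> once and give \<open>T\<close>; the others
  are reversed \<open>extra_parents\<close> and give \<open>\<xi>\<close>.\<close>

lemma sum_to_W_le: "(\<Sum>v\<in>nb u. \<Sum>w\<in>nb v \<inter> W. x w) \<le> T + \<xi>"
proof -
  let ?S = "SIGMA v:nb u. nb v \<inter> W" and ?A = "(\<lambda>w. (parent w, w)) ` W1"
  let ?B = "(\<lambda>(w, v). (v, w)) ` extra_parents"
  have S: "?S = ?A \<union> ?B"
  proof (intro equalityI subsetI)
    fix e assume "e \<in> ?S"
    then obtain v w where e: "e = (v, w)" "v \<in> nb u" "w \<in> nb v" "w \<in> W" by auto
    then have "w \<in> W1" by (auto simp: W1_def intro: adj_sym)
    then show "e \<in> ?A \<union> ?B"
      using e by (cases "v = parent w") (auto simp: extra_parents_def image_iff intro: adj_sym)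
  next
    fix e assume "e \<in> ?A \<union> ?B"
    then show "e \<in> ?S"
      using parent layers_disjoint by (auto simp: extra_parents_def intro: adj_sym)
  qed
  have "(\<Sum>v\<in>nb u. \<Sum>w\<in>nb v \<inter> W. x w) = (\<Sum>(v, w)\<in>?S. x w)"
    using finite_nb by (intro sum.Sigma) auto
  also have "\<dots> = (\<Sum>(v, w)\<in>?A. x w) + (\<Sum>(v, w)\<in>?B. x w)"
    unfolding S using finite_layers finite_extra_parents
    by (intro sum.union_disjoint) (auto simp: extra_parents_def)
  also have "(\<Sum>(v, w)\<in>?A. x w) = (\<Sum>w\<in>W1. x w)"
    by (subst sum.reindex) (auto simp: inj_on_def)
  also have "\<dots> \<le> T" unfolding T_def by (intro sum_mono) auto
  also have "(\<Sum>(v, w)\<in>?B. x w) = (\<Sum>(w, v)\<in>extra_parents. x w)"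
    by (subst sum.reindex) (auto simp: inj_on_def intro!: sum.cong)
  also have "\<dots> \<le> \<xi>" unfolding \<xi>_def by (intro sum_mono) auto
  finally show ?thesis by simp
qed

lemma nb_inter_nb:
  assumes "(a, b) \<in> nb_edges"
  shows "nb a \<inter> nb u = {b}"
proof (intro equalityI subsetI)
  fix z assume "z \<in> nb a \<inter> nb u"
  then have "(a, z) \<in> nb_edges" using assms by (simp add: nb_edges_def)
  from nb_edges_unique[OF assms this] show "z \<in> {b}" by (auto simp: doubleton_eq_iff)
qed (use assms in \<open>simp add: nb_edges_def\<close>)

text \<open>For the only possible edge \<open>ab\<close> inside \<open>nb u\<close>, the sum is
  \<open>x a + x b\<close>. Adding the eigenvalue equations at \<open>a\<close> and \<open>b\<close>
  gives the bound, as their neighbours in \<open>W\<close> are disjoint subsets of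
  \<open>W1\<close>.\<close>

lemma sum_in_nb_le: "(k - 1) * (\<Sum>v\<in>nb u. \<Sum>z\<in>nb v \<inter> nb u. x z) \<le> 2 + T"
proof -
  have "(\<Sum>v\<in>nb u. \<Sum>z\<in>nb v \<inter> nb u. x z) = (\<Sum>(v, z)\<in>(SIGMA v:nb u. nb v \<inter> nb u). x z)"
    using finite_nb by (intro sum.Sigma) auto
  also have "(SIGMA v:nb u. nb v \<inter> nb u) = nb_edges" by (auto simp: nb_edges_def)
  finally have eq: "(\<Sum>v\<in>nb u. \<Sum>z\<in>nb v \<inter> nb u. x z) = (\<Sum>(v, z)\<in>nb_edges. x z)" .
  have T0: "T \<ge> 0" by (simp add: T_def sum_nonneg)
  show ?thesis
  proof (cases "nb_edges = {}")
    case True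
    then show ?thesis using T0 by (simp add: eq)
  next
    case False
    then obtain a b where ab: "(a, b) \<in> nb_edges" by auto
    then have ab': "a \<in> nb u" "b \<in> nb u" "(a, b) \<in> parcs G" "(b, a) \<in> parcs G" "a \<noteq> b"
      using adj_irrefl by (auto simp: nb_edges_def intro: adj_sym)
    have edges: "nb_edges = {(a, b), (b, a)}"
    proof (intro equalityI subsetI)
      fix s assume "s \<in> nb_edges"
      then show "s \<in> {(a, b), (b, a)}"
        using nb_edges_unique[OF ab, of "fst s" "snd s"]
        by (cases s) (auto simp: doubleton_eq_iff)
    qed (use ab ab' in \<open>auto simp: nb_edges_def\<close>)
    have nba: "nb a \<inter> nb u = {b}" "nb b \<inter> nb u = {a}"
      using ab ab' by (intro nb_inter_nb; simp add: nb_edges_def)+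
    \<comment> \<open>A common neighbour in \<open>W\<close> would form a second triangle on
      \<open>ab\<close>, besides the one through \<open>u\<close>.\<close>
    have disj: "(nb a \<inter> W) \<inter> (nb b \<inter> W) = {}"
    proof (rule ccontr)
      assume "\<not> ?thesis"
      then obtain w where w: "(a, w) \<in> parcs G" "(b, w) \<in> parcs G" "w \<in> W" by auto
      have nw: "w \<noteq> a" "w \<noteq> b" "w \<noteq> u" "a \<noteq> u" "b \<noteq> u"
        using w ab' layerD(1) root_notin by auto
      have eq: "{{a, b}, {b, w}, {w, a}} = {{a, b}, {b, u}, {u, a}}"
      proof (rule cycle_unique)
        have d: "distinct [a, b, w]" "distinct [a, b, u]" "a \<in> pverts G"
          using nw ab' in_arcsD1[OF w(1)] by auto
        show "{{a, b}, {b, w}, {w, a}} \<in> cycle_subgraphs G"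
          "{{a, b}, {b, u}, {u, a}} \<in> cycle_subgraphs G"
          using cycle_subgraphs_3(1)[of a b G w] cycle_subgraphs_3(1)[of a b G u] d ab' w
          by (auto intro: adj_sym)
        show "card {{a, b}, {b, w}, {w, a}} = card {{a, b}, {b, u}, {u, a}}"
          using nw ab' by (auto simp: doubleton_eq_iff card_insert_if)
      qed
      have "{b, w} \<in> {{a, b}, {b, u}, {u, a}}" unfolding eq[symmetric] by simp
      then show False using nw ab'(5) by (auto simp: doubleton_eq_iff)
    qed
    have ka: "k * x a = 1 + x b + sum x (nb a \<inter> W)"
      using sum_nb_split[OF ab'(1), of x] eigen[OF in_arcsD1[OF ab'(3)]]
      unfolding nba by (simp add: x_root)
    have kb: "k * x b = 1 + x a + sum x (nb b \<inter> W)"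
      using sum_nb_split[OF ab'(2), of x] eigen[OF in_arcsD1[OF ab'(4)]]
      unfolding nba by (simp add: x_root)
    have "sum x (nb a \<inter> W) + sum x (nb b \<inter> W) = sum x ((nb a \<inter> W) \<union> (nb b \<inter> W))"
      using disj finite_nb by (intro sum.union_disjoint[symmetric]) auto
    also have "\<dots> \<le> (\<Sum>w\<in>(nb a \<inter> W) \<union> (nb b \<inter> W). \<bar>x w\<bar>)"
      by (intro sum_mono) auto
    also have "\<dots> \<le> T"
      unfolding T_def using finite_layers ab'
      by (intro sum_mono2) (auto simp: W1_def intro: adj_sym)
    finally have "(k - 1) * (x a + x b) \<le> 2 + T" using ka kb by (simp add: algebra_simps)
    then show ?thesis using ab'(5) by (simp add: eq edges add.commute)
  qed
qed

text \<open>Since the order of the graph is \<open>1 + card (nb u) + card W\<close>,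
  \<open>k_ge_star_plus\<close> becomes \<open>2 \<le> (k - 1) * (?P + ?S - card W)\<close>. This 2
  cancels exactly against the 2 in \<open>sum_in_nb_le\<close>.\<close>

lemma card_W_le: "(k - 1) * real (card W) \<le> k * T + (k - 1) * \<xi>"
proof -
  let ?P = "\<Sum>v\<in>nb u. \<Sum>z\<in>nb v \<inter> nb u. x z" and ?S = "\<Sum>v\<in>nb u. \<Sum>w\<in>nb v \<inter> W. x w"
  have "k\<^sup>2 = k * (\<Sum>v\<in>nb u. x v)"
    using eigen[OF root] x_root by (simp add: power2_eq_square)
  also have "\<dots> = (\<Sum>v\<in>nb u. sum x (nb v))"
    unfolding sum_distrib_left using eigen nb_subset[of u] by (intro sum.cong) auto
  also have "\<dots> = (\<Sum>v\<in>nb u. 1 + sum x (nb v \<inter> nb u) + sum x (nb v \<inter> W))"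
    using x_root by (intro sum.cong) (auto simp: sum_nb_split)
  also have "\<dots> = real (card (nb u)) + ?P + ?S" by (simp add: sum.distrib)
  finally have k2: "k\<^sup>2 = real (card (nb u)) + ?P + ?S" .
  have "card (pverts G) = Suc (card (nb u \<union> W))"
    unfolding vertices_layers using root_notin finite_nb finite_layers by simp
  also have "card (nb u \<union> W) = card (nb u) + card W"
    using finite_nb finite_layers layers_disjoint by (intro card_Un_disjoint)
  finally have "k\<^sup>2 - (real (card (pverts G)) - 1) = ?P + ?S - real (card W)"
    using k2 by simp
  then have "2 \<le> (k - 1) * (?P + ?S - real (card W))"
    using k_ge_star_plus by simp
  then have "2 \<le> (k - 1) * ?P + (k - 1) * ?S - (k - 1) * real (card W)"
    by (simp only: distrib_left right_diff_distrib)
  moreover have "(k - 1) * ?S \<le> (k - 1) * (T + \<xi>)"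
    using sum_to_W_le k_ge_5 by (intro mult_left_mono) auto
  ultimately show ?thesis using sum_in_nb_le by (simp add: algebra_simps)
qed

section \<open>Excluding vertices outside the neighbourhood of the root\<close>

text \<open>With \<open>\<xi> \<le> 1\<close> and \<open>k \<ge> 5\<close>, a nonempty
  \<open>W\<close> satisfies \<open>4 * (card W - 1) \<le> card W + 7\<close>, that is
  \<open>3 * card W \<le> 11\<close>.\<close>

lemma card_W_le_3: "card W \<le> 3"
proof -
  have "\<xi> \<le> 1" using x_le vertices_layers by (intro xi_le) auto
  then have "(k - 1) * \<xi> \<le> (k - 1) * 1" using k_ge_5 by (intro mult_left_mono) auto
  then have "(k - 1) * (real (card W) - 1) \<le> real (card W) + 7"
    using card_W_le k_T_le by (simp add: algebra_simps)
  moreover have "4 * (real (card W) - 1) \<le> (k - 1) * (real (card W) - 1)" if "card W \<ge> 1"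
    using k_ge_5 that by (intro mult_right_mono) auto
  ultimately show ?thesis by (cases "card W \<ge> 1") auto
qed

lemma sum_abs_le_card:
  assumes "finite A" "\<And>v. v \<in> A \<Longrightarrow> \<bar>x v\<bar> \<le> c" "c \<ge> 0" "card A \<le> m"
  shows "(\<Sum>v\<in>A. \<bar>x v\<bar>) \<le> real m * c"
proof -
  have "(\<Sum>v\<in>A. \<bar>x v\<bar>) \<le> real (card A) * c" using assms(2) by (rule sum_bounded_above)
  also have "\<dots> \<le> real m * c" using assms(3,4) by (intro mult_right_mono) auto
  finally show ?thesis .
qed

lemma card_nb_inter_nb: "card (nb v \<inter> nb u) \<le> 1" if "v \<in> nb u"
proof (cases "nb v \<inter> nb u = {}")
  case False
  then obtain z where "z \<in> nb v \<inter> nb u" by blast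
  then have "(v, z) \<in> nb_edges" using that by (simp add: nb_edges_def)
  then show ?thesis by (simp add: nb_inter_nb)
qed simp

lemma card_parents: "card (nb w \<inter> nb u) \<le> 2" if "w \<in> W"
proof -
  have "nb w \<inter> nb u \<subseteq> insert (parent w) (snd ` extra_parents)"
    using that by (force simp: extra_parents_def W1_def)
  then have "card (nb w \<inter> nb u) \<le> card (insert (parent w) (snd ` extra_parents))"
    using finite_extra_parents by (intro card_mono) auto
  also have "\<dots> \<le> Suc (card (snd ` extra_parents))" by (rule card_insert_le_m1) auto
  also have "\<dots> \<le> Suc (card extra_parents)"
    using card_image_le[OF finite_extra_parents] by simp
  finally show ?thesis using card_extra_parents by simp
qed

text \<open>For the maxima \<open>?N\<close> and \<open>?W\<close> of the moduli on
  \<open>nb u\<close> and \<open>W\<close>, the eigenvalue equations give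
  \<open>4 * ?N \<le> 1 + 3 * ?W\<close> and \<open>3 * ?W \<le> 2 * ?N\<close>, hence
  \<open>6 * ?W \<le> 1 + 3 * ?W\<close>.\<close>

lemma x_le_third: "\<bar>x w\<bar> \<le> 1 / 3" if "w \<in> W"
proof -
  \<comment> \<open>The inserted 0 is the value for an empty set.\<close>
  define M where "M A = Max (insert 0 ((\<lambda>v. \<bar>x v\<bar>) ` A))" for A
  have M0: "M A \<ge> 0" and M: "v \<in> A \<Longrightarrow> \<bar>x v\<bar> \<le> M A" if "finite A" for A v
    unfolding M_def using that by (auto intro!: Max_ge)
  have Mcases: "M A = 0 \<or> (\<exists>v\<in>A. M A = \<bar>x v\<bar>)" if "finite A" for A
    unfolding M_def using that Max_in[of "insert 0 ((\<lambda>v. \<bar>x v\<bar>) ` A)"] by auto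
  let ?N = "M (nb u)" and ?W = "M W"
  note N = M0[OF finite_nb[of u]] M[OF finite_nb[of u]]
    and W = M0[OF finite_layers(1)] M[OF finite_layers(1)]
  have "k * \<bar>x v\<bar> \<le> 1 + ?N + 3 * ?W" if v: "v \<in> nb u" for v
  proof -
    have "card (nb v \<inter> W) \<le> 3"
      using card_W_le_3 card_mono[OF finite_layers(1), of "nb v \<inter> W"] by auto
    then have "(\<Sum>z\<in>nb v \<inter> W. \<bar>x z\<bar>) \<le> real 3 * ?W"
      using W finite_nb by (intro sum_abs_le_card) auto
    moreover have "(\<Sum>z\<in>nb v \<inter> nb u. \<bar>x z\<bar>) \<le> real 1 * ?N"
      using N finite_nb card_nb_inter_nb[OF v] by (intro sum_abs_le_card) auto
    ultimately show ?thesis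
      using eigen_abs_le[of v] sum_nb_split[OF v, of "\<lambda>z. \<bar>x z\<bar>"] v nb_subset[of u] x_root by auto
  qed
  then have "k * ?N \<le> 1 + ?N + 3 * ?W"
    using Mcases[OF finite_nb, of u] N(1) W(1) by fastforce
  moreover have "4 * ?N \<le> (k - 1) * ?N" using k_ge_5 N(1) by (intro mult_right_mono) auto
  ultimately have 1: "4 * ?N \<le> 1 + 3 * ?W" by (simp add: algebra_simps)
  \<comment> \<open>At most two neighbours lie in \<open>nb u\<close>, and at most two in
    \<open>W\<close>, which has at most three elements including \<open>w\<close> itself.\<close>
  have "k * \<bar>x w\<bar> \<le> 2 * ?N + 2 * ?W" if w: "w \<in> W" for w
  proof -
    have "nb w = (nb w \<inter> nb u) \<union> (nb w \<inter> W)"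
    proof -
      have "u \<notin> nb w" using w adj_sym[of w u] layers_disjoint(1) by blast
      then show ?thesis using nb_subset[of w] unfolding vertices_layers by blast
    qed
    moreover have "(\<Sum>z\<in>(nb w \<inter> nb u) \<union> (nb w \<inter> W). \<bar>x z\<bar>) =
        (\<Sum>z\<in>nb w \<inter> nb u. \<bar>x z\<bar>) + (\<Sum>z\<in>nb w \<inter> W. \<bar>x z\<bar>)"
      using finite_nb layers_disjoint by (intro sum.union_disjoint) auto
    ultimately have split: "(\<Sum>z\<in>nb w. \<bar>x z\<bar>) =
        (\<Sum>z\<in>nb w \<inter> nb u. \<bar>x z\<bar>) + (\<Sum>z\<in>nb w \<inter> W. \<bar>x z\<bar>)" by simp
    have "card (nb w \<inter> W) \<le> card (W - {w})"
      using finite_layers adj_irrefl by (intro card_mono) auto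
    then have "card (nb w \<inter> W) \<le> 2"
      using card_W_le_3 w finite_layers by simp
    then have "(\<Sum>z\<in>nb w \<inter> W. \<bar>x z\<bar>) \<le> real 2 * ?W"
      using W finite_nb by (intro sum_abs_le_card) auto
    moreover have "(\<Sum>z\<in>nb w \<inter> nb u. \<bar>x z\<bar>) \<le> real 2 * ?N"
      using N finite_nb card_parents[OF w] by (intro sum_abs_le_card) auto
    ultimately show ?thesis
      using eigen_abs_le[of w] split w vertices_layers by auto
  qed
  then have "k * ?W \<le> 2 * ?N + 2 * ?W"
    using Mcases[OF finite_layers(1)] N(1) W(1) by fastforce
  moreover have "3 * ?W \<le> (k - 2) * ?W" using k_ge_5 W(1) by (intro mult_right_mono) auto
  ultimately have "3 * ?W \<le> 2 * ?N" by (simp add: algebra_simps)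
  with 1 have "?W \<le> 1 / 3" by linarith
  then show ?thesis using W(2)[OF that] by linarith
qed

text \<open>Now \<open>T \<le> card W / 3\<close> and \<open>\<xi> \<le> 1 / 3\<close>, so
  \<open>card_W_le\<close> with \<open>k \<ge> 5\<close> yields
  \<open>7 * card W \<le> 4\<close>.\<close>

lemma W_empty: "W = {}"
proof (rule ccontr)
  assume "W \<noteq> {}"
  then have "card W \<ge> 1" using finite_layers by (simp add: Suc_le_eq card_gt_0_iff)
  then have m: "real (card W) \<ge> 1" by simp
  have "T \<le> real (card W) * (1 / 3)"
    unfolding T_def using finite_layers layers_disjoint x_le_third
    by (intro sum_abs_le_card card_mono) auto
  then have "k * T \<le> k * (real (card W) * (1 / 3))"
    using k_ge_5 by (intro mult_left_mono) auto
  moreover have "(k - 1) * \<xi> \<le> (k - 1) * (1 / 3)"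
    using k_ge_5 x_le_third by (intro mult_left_mono xi_le) auto
  ultimately have "k * (2 * real (card W) - 1) \<le> 3 * real (card W) - 1"
    using card_W_le by (simp add: algebra_simps)
  moreover have "5 * (2 * real (card W) - 1) \<le> k * (2 * real (card W) - 1)"
    using k_ge_5 m by (intro mult_right_mono) auto
  ultimately have "5 * (2 * real (card W) - 1) \<le> 3 * real (card W) - 1"
    by (rule order_trans[rotated])
  then show False using m by (simp add: algebra_simps)
qed

section \<open>Identifying the star with an additional edge\<close>

text \<open>In a plain star \<open>k\<^sup>2\<close> is the number of leaves, so the left side of
  \<open>k_ge_star_plus\<close> would be 0.\<close>

lemma nb_edges_nonempty: "nb_edges \<noteq> {}"
proof
  assume e: "nb_edges = {}"
  have "k * x v = 1" if v: "v \<in> nb u" for v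
  proof -
    have "nb v \<inter> nb u = {}" using e v by (auto simp: nb_edges_def)
    then show ?thesis
      using eigen[of v] sum_nb_split[OF v, of x] v nb_subset[of u] W_empty x_root by auto
  qed
  then have "k * (\<Sum>v\<in>nb u. x v) = real (card (nb u))" by (simp add: sum_distrib_left)
  then have "k\<^sup>2 = real (card (nb u))"
    using eigen[OF root] x_root by (simp add: power2_eq_square)
  moreover have "card (pverts G) = Suc (card (nb u))"
    using vertices_layers W_empty root_notin finite_nb by simp
  ultimately show False using k_ge_star_plus by simp
qed

text \<open>As \<open>W\<close> is empty, an edge avoiding \<open>u\<close> lies inside
  \<open>nb u\<close>, and uniqueness of the triangle leaves only \<open>ab\<close>. So
  \<open>u\<close>, \<open>a\<close>, \<open>b\<close> go to 0, 1, 2 and the other leaves to the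
  remaining numbers.\<close>

lemma iso_star_plus: "digraph_iso (with_proj G) (with_proj (star_plus (card (pverts G))))"
proof -
  let ?n = "card (pverts G)"
  obtain a b where "(a, b) \<in> nb_edges" using nb_edges_nonempty by auto
  then have ab: "(u, a) \<in> parcs G" "(u, b) \<in> parcs G" "(a, b) \<in> parcs G" "(b, a) \<in> parcs G"
      "a \<noteq> b" and e: "(a, b) \<in> nb_edges"
    using adj_irrefl by (auto simp: nb_edges_def intro: adj_sym)
  define R where "R = nb u - {a, b}"
  have V: "pverts G = insert u (nb u)" using vertices_layers W_empty by simp
  have fin: "finite R" using finite_nb by (simp add: R_def)
  have nb: "nb u = insert a (insert b R)" using ab by (auto simp: R_def)
  have notin: "u \<noteq> a" "u \<noteq> b" "u \<notin> R" "a \<notin> R" "b \<notin> R"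
    using ab layerD(1) adj_irrefl by (auto simp: R_def)
  have VR: "pverts G = insert u (insert a (insert b R))" using V nb by simp
  then have n: "?n = card R + 3" using fin notin ab(5) by simp
  have arcs: "parcs G = {u} \<times> nb u \<union> nb u \<times> {u} \<union> {(a, b), (b, a)}" (is "_ = ?R")
  proof (intro equalityI subsetI)
    fix s assume s: "s \<in> parcs G"
    obtain p q where pq: "s = (p, q)" by fastforce
    have "p = u \<or> p \<in> nb u" "q = u \<or> q \<in> nb u"
      using s in_arcsD1 in_arcsD2 V by (auto simp: pq)
    moreover have "{p, q} = {a, b}" if "p \<in> nb u" "q \<in> nb u"
      using that s by (intro nb_edges_unique[OF e]) (simp add: nb_edges_def pq)
    ultimately show "s \<in> ?R"
      using s adj_irrefl by (auto simp: pq doubleton_eq_iff)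
  qed (use ab in \<open>auto intro: adj_sym\<close>)
  obtain h where h: "bij_betw h R {3..<?n}"
    using finite_same_card_bij[OF fin, of "{3..<?n}"] n
    by (metis card_atLeastLessThan diff_add_inverse2 finite_atLeastLessThan)
  define f where "f v = (if v = u then 0 else if v = a then 1 else if v = b then 2 else h v)" for v
  have f: "f u = 0" "f a = 1" "f b = 2" using notin ab(5) by (auto simp: f_def)
  have "f ` R = h ` R" using notin by (intro image_cong) (auto simp: f_def)
  then have fR: "f ` R = {3..<?n}" using bij_betw_imp_surj_on[OF h] by simp
  have "f ` nb u = insert 1 (insert 2 {3..<?n})" unfolding nb by (simp add: f fR)
  also have "\<dots> = {1..<?n}" using n by auto
  finally have fnb: "f ` nb u = {1..<?n}" .
  have "f ` pverts G = insert 0 {1..<?n}"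
    using arg_cong[OF V, of "image f"] by (simp only: image_insert f fnb)
  also have "\<dots> = {..<?n}" using n by auto
  finally have fV: "f ` pverts G = {..<?n}" .
  \<comment> \<open>The image has as many elements as the domain.\<close>
  then have inj: "inj_on f (pverts G)"
    by (intro eq_card_imp_inj_on) (simp_all add: pair_finite_verts)
  have mp: "map_prod f f ` (A \<times> B) = f ` A \<times> f ` B" for A B
    by (rule map_prod_surj_on) simp_all
  have "map_prod f f ` parcs G = {0} \<times> {1..<?n} \<union> {1..<?n} \<times> {0} \<union> {(1, 2), (2, 1)}"
    by (subst arcs) (simp only: image_Un mp fnb f image_insert image_empty map_prod_simp)
  moreover have star: "pverts (star_plus m) = {..<m}"
      "parcs (star_plus m) = {0} \<times> {1..<m} \<union> {1..<m} \<times> {0} \<union> {(1, 2), (2, 1)}"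
    if "m \<ge> 3" for m
    using that by (auto simp: star_plus_def complete_bipartite_def)
  ultimately have fA: "map_prod f f ` parcs G = parcs (star_plus ?n)" using n by simp
  define iso where
    "iso = \<lparr>iso_verts = f, iso_arcs = map_prod f f, iso_head = snd, iso_tail = fst\<rparr>"
  have "inj_on (map_prod f f) (parcs G)"
    using in_arcsD1 in_arcsD2 by (intro inj_onI) (auto dest!: inj_onD[OF inj])
  moreover have "wf_digraph (with_proj G)" by (rule wf_digraph_axioms)
  ultimately have "pre_digraph.digraph_isomorphism (with_proj G) iso"
    using inj by (auto simp: pre_digraph.digraph_isomorphism_def iso_def)
  moreover have "with_proj (star_plus ?n) = app_iso iso (with_proj G)"
    using n by (simp add: with_proj_def app_iso_def iso_def fA fV star(1))
  ultimately show ?thesis unfolding digraph_iso_def by blast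
qed

end

theorem theorem2:
  fixes G :: "'a pair_pre_digraph" and n :: nat
  assumes "pair_graph G"
    and "card (pverts G) = n"
    and "n \<ge> 26"
    and "graph_spectral_radius G \<ge> graph_spectral_radius (star_plus n)"
    and "\<not> digraph_iso (with_proj G) (with_proj (star_plus n))"
  shows "has_two_cycles_of_same_length G"
proof (rule ccontr)
  assume no: "\<not> has_two_cycles_of_same_length G"
  interpret pair_graph G by (rule assms(1))
  define k where "k = graph_spectral_radius G"
  have ne: "pverts G \<noteq> {}" using assms(2,3) by auto
  obtain y where y: "\<exists>v\<in>pverts G. y v \<noteq> 0"
    "\<And>v. v \<in> pverts G \<Longrightarrow> (\<Sum>z | (v, z) \<in> parcs G. y z) = k * y v"
    using graph_spectral_radius_in_spectrum[OF assms(1) ne]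
    unfolding eigenvalue_adjacency_iff[OF assms(1)] k_def by blast
  let ?Y = "(\<lambda>v. \<bar>y v\<bar>) ` pverts G"
  have "Max ?Y \<in> ?Y" using pair_finite_verts ne by (intro Max_in) auto
  then obtain u where u: "u \<in> pverts G" "Max ?Y = \<bar>y u\<bar>" by auto
  have max: "\<bar>y v\<bar> \<le> \<bar>y u\<bar>" if "v \<in> pverts G" for v
    unfolding u(2)[symmetric] using that pair_finite_verts by (intro Max_ge) auto
  \<comment> \<open>Otherwise the maximality of \<open>u\<close> would make \<open>y\<close> vanish
    everywhere.\<close>
  have yu: "y u \<noteq> 0" using y(1) max by fastforce
  obtain c where c: "c \<ge> 5" "(c - 1) * (c\<^sup>2 - (real n - 1)) = 2" "c \<le> k"
    using graph_spectral_radius_star_plus[OF assms(3)] assms(4) unfolding k_def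
    by (metis order_trans)
  \<comment> \<open>Nonnegativity of this factor makes the product monotone when \<open>c\<close> is
    replaced by \<open>k\<close>.\<close>
  have "c\<^sup>2 - (real n - 1) \<ge> 0"
    using c(1,2) by (smt (verit) mult_pos_neg)
  moreover have "c\<^sup>2 \<le> k\<^sup>2" using c by (intro power_mono) auto
  ultimately have "(c - 1) * (c\<^sup>2 - (real n - 1)) \<le> (k - 1) * (k\<^sup>2 - (real n - 1))"
    using c by (intro mult_mono) auto
  then have k: "(k - 1) * (k\<^sup>2 - (real (card (pverts G)) - 1)) \<ge> 2"
    using c assms(2) by simp
  interpret rooted_eigenvector G u "\<lambda>v. y v / y u" k
  proof unfold_locales
    show "(\<Sum>z | (v, z) \<in> parcs G. y z / y u) = k * (y v / y u)" if "v \<in> pverts G" for v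
      using y(2)[OF that] by (simp add: sum_divide_distrib[symmetric])
  qed (use no u(1) max yu c k in \<open>auto simp: divide_le_eq_1\<close>)
  from iso_star_plus assms(2,5) show False by simp
qed

end
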